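(* Let $(\Omega,*,I)$ be a commutative unital quantale and let $A$ be a completely distributive $\Omega$-lattice. Then the subalgebras of $A$ correspond bijectively to the cocontinuous closure operators on $A$: the assignments $B\mapsto c_B$, where $c_B(x)=\bigwedge\{y\in B: x\le y\}$, and $c\mapsto c(A)=\{c(x): x\in A\}$, are mutually inverse bijections between the set of subalgebras $B$ of $A$ and the set of cocontinuous closure operators $c$ on $A$.
   Context: A commutative unital quantale $(\Omega,*,I)$ is a complete lattice $\Omega$ with a commutative, associative binary operation $*$, monotone in each variable, with unit $I$ (not necessarily the top element), such that each $\alpha*(-)$ has a right adjoint $\alpha\to(-)$: $\alpha*\beta\le\gamma\iff\beta\le\alpha\to\gamma$. An $\Omega$-category is a set $A$ with a map $A(-,-):A\times A\to\Omega$ such that $I\le A(a,a)$ and $A(a,b)*A(b,c)\le A(a,c)$. An $\Omega$-functor $f:A\to B$ is a function with $A(a,b)\le B(f(a),f(b))$. The dual is $A^{\rm op}(a,b)=A(b,a)$. $A_0$ is the underlying set of $A$ with the preorder $a\le b\iff I\le A(a,b)$; $A$ is antisymmetric if $A_0$ is a partial order. $\Omega$ is an $\Omega$-category via $\Omega(\alpha,\beta)=\alpha\to\beta$. $[A,B]$ is the $\Omega$-category of $\Omega$-functors with $[A,B](f,g)=\bigwedge_{x}B(f(x),g(x))$. $\Omega$-functors $f:A\to B$, $g:B\to A$ form an adjunction ($f$ left adjoint of $g$) if $B(f(a),b)=A(a,g(b))$ for all $a,b$. For $\phi:A\to\Omega$, $\sup\phi$ is an element $a$ with $A(a,x)=\bigwedge_{z}(\phi(z)\to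 A(z,x))$ for all $x$. A complete $\Omega$-lattice is an antisymmetric $\Omega$-category in which every function $A\to\Omega$ has a supremum; then $A_0$ is a complete lattice (joins $\bigvee$ and meets $\bigwedge$ in $A$ are taken in $A_0$), and $A$ has tensors $\alpha\otimes x$ and cotensors $\alpha\rightarrowtail x$, characterized by $A(\alpha\otimes x,y)=\alpha\to A(x,y)$ and $A(z,\alpha\rightarrowtail x)=\alpha\to A(z,x)$. $A$ is completely distributive if $\sup:[A^{\rm op},\Omega]\to A$ has a left adjoint. A subalgebra of a complete $\Omega$-lattice $A$ is a subset $B$, with hom inherited from $A$, closed under all tensors and cotensors of $A$ and under all joins and meets of $A_0$ (equivalently, the inclusion $B\to A$ has both a left and a right adjoint). A closure operator on $A$ is an $\Omega$-functor $c:A\to A$ with $c\circ c=c$ and $A(x,c(x))\ge I$ for all $x$. An $\Omega$-functor $f:A\to B$ is cocontinuous if it preserves sups: $f(\sup\mu)=\sup f(\mu)$ for every $\mu:A\to\Omega$ whose supremum exists, where $f(\mu)(b)=\bigvee_{x\in f^{-1}(b)}\mu(x)$. *)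

theory Defs
  imports "HOL-Algebra.Lattice"
begin

section \<open>Commutative unital quantales\<close>

text \<open>
  The unit is \<open>1\<close>, which need not be the top element. Monotonicity of the multiplication is
  not an axiom because it follows from the adjunction; see \<open>quantale_mult_mono\<close>.
\<close>

class comm_unital_quantale = complete_lattice + comm_monoid_mult +
  fixes residual :: "'a \<Rightarrow> 'a \<Rightarrow> 'a"  (infixr \<open>\<leadsto>\<close> 60)
  assumes residuation: "a * b \<le> c \<longleftrightarrow> b \<le> a \<leadsto> c"

lemma quantale_mult_mono:
  fixes a b c d :: "'q::comm_unital_quantale"
  assumes "a \<le> b" "c \<le> d"
  shows "a * c \<le> b * d"
proof -
  have right: "x * y \<le> x * z" if "y \<le> z" for x y z :: 'q
  proof -
    have "z \<le> x \<leadsto> x * z" by (simp only: residuation [symmetric] order_refl)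
    with that have "y \<le> x \<leadsto> x * z" by (rule order_trans)
    then show ?thesis by (simp only: residuation)
  qed
  have "a * c \<le> a * d" using assms(2) by (rule right)
  also have "\<dots> = d * a" by (rule mult.commute)
  also have "\<dots> \<le> d * b" using assms(1) by (rule right)
  also have "\<dots> = b * d" by (rule mult.commute)
  finally show ?thesis .
qed

section \<open>Categories enriched in a quantale\<close>

record ('a, 'q) ocat = "'a partial_object" +
  ehom :: "'a \<Rightarrow> 'a \<Rightarrow> 'q"

definition omega_category :: "('a, 'q::comm_unital_quantale) ocat \<Rightarrow> bool" where
  "omega_category A \<longleftrightarrow>
     (\<forall>a\<in>carrier A. 1 \<le> ehom A a a) \<and>
     (\<forall>a\<in>carrier A. \<forall>b\<in>carrier A. \<forall>c\<in>carrier A. ehom A a b * ehom A b c \<le> ehom A a c)"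

text \<open>
  Maps out of a carrier are extensional (\<open>undefined\<close> outside of it), so that HOL equality
  of functors is equality of maps.
\<close>

definition omega_functor ::
    "('a, 'q::comm_unital_quantale) ocat \<Rightarrow> ('b, 'q) ocat \<Rightarrow> ('a \<Rightarrow> 'b) \<Rightarrow> bool" where
  "omega_functor A B f \<longleftrightarrow>
     f \<in> carrier A \<rightarrow>\<^sub>E carrier B \<and>
     (\<forall>a\<in>carrier A. \<forall>b\<in>carrier A. ehom A a b \<le> ehom B (f a) (f b))"

definition op_cat :: "('a, 'q) ocat \<Rightarrow> ('a, 'q) ocat" where
  "op_cat A = \<lparr>carrier = carrier A, ehom = (\<lambda>a b. ehom A b a)\<rparr>"

definition Omega :: "('q::comm_unital_quantale, 'q) ocat" where
  "Omega = \<lparr>carrier = UNIV, ehom = (\<leadsto>)\<rparr>"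

definition functor_cat ::
    "('a, 'q::comm_unital_quantale) ocat \<Rightarrow> ('b, 'q) ocat \<Rightarrow> ('a \<Rightarrow> 'b, 'q) ocat" where
  "functor_cat A B =
     \<lparr>carrier = {f. omega_functor A B f},
      ehom = (\<lambda>f g. INF x\<in>carrier A. ehom B (f x) (g x))\<rparr>"

definition adjunction ::
    "('a, 'q::comm_unital_quantale) ocat \<Rightarrow> ('b, 'q) ocat \<Rightarrow> ('a \<Rightarrow> 'b) \<Rightarrow> ('b \<Rightarrow> 'a) \<Rightarrow> bool" where
  "adjunction A B f g \<longleftrightarrow>
     omega_functor A B f \<and> omega_functor B A g \<and>
     (\<forall>a\<in>carrier A. \<forall>b\<in>carrier B. ehom B (f a) b = ehom A a (g b))"

definition underlying :: "('a, 'q::comm_unital_quantale) ocat \<Rightarrow> 'a gorder" where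
  "underlying A = \<lparr>carrier = carrier A, eq = (=), le = (\<lambda>a b. 1 \<le> ehom A a b)\<rparr>"

definition antisymmetric :: "('a, 'q::comm_unital_quantale) ocat \<Rightarrow> bool" where
  "antisymmetric A \<longleftrightarrow> partial_order (underlying A)"

section \<open>Suprema, tensors and complete distributivity\<close>

definition is_osup ::
    "('a, 'q::comm_unital_quantale) ocat \<Rightarrow> ('a \<Rightarrow> 'q) \<Rightarrow> 'a \<Rightarrow> bool" where
  "is_osup A \<phi> a \<longleftrightarrow>
     a \<in> carrier A \<and>
     (\<forall>x\<in>carrier A. ehom A a x = (INF z\<in>carrier A. \<phi> z \<leadsto> ehom A z x))"

definition osup :: "('a, 'q::comm_unital_quantale) ocat \<Rightarrow> ('a \<Rightarrow> 'q) \<Rightarrow> 'a" where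
  "osup A \<phi> = (THE a. is_osup A \<phi> a)"

definition complete_omega_lattice :: "('a, 'q::comm_unital_quantale) ocat \<Rightarrow> bool" where
  "complete_omega_lattice A \<longleftrightarrow>
     omega_category A \<and> antisymmetric A \<and> (\<forall>\<phi>. \<exists>a. is_osup A \<phi> a)"

definition tensor :: "('a, 'q::comm_unital_quantale) ocat \<Rightarrow> 'q \<Rightarrow> 'a \<Rightarrow> 'a" where
  "tensor A \<alpha> x =
     (THE t. t \<in> carrier A \<and> (\<forall>y\<in>carrier A. ehom A t y = \<alpha> \<leadsto> ehom A x y))"

definition cotensor :: "('a, 'q::comm_unital_quantale) ocat \<Rightarrow> 'q \<Rightarrow> 'a \<Rightarrow> 'a" where
  "cotensor A \<alpha> x =
     (THE t. t \<in> carrier A \<and> (\<forall>z\<in>carrier A. ehom A z t = \<alpha> \<leadsto> ehom A z x))"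

definition completely_distributive :: "('a, 'q::comm_unital_quantale) ocat \<Rightarrow> bool" where
  "completely_distributive A \<longleftrightarrow>
     (let P = functor_cat (op_cat A) Omega
      in \<exists>t. adjunction A P t (restrict (osup A) (carrier P)))"

section \<open>Subalgebras and cocontinuous closure operators\<close>

definition subalgebra :: "('a, 'q::comm_unital_quantale) ocat \<Rightarrow> 'a set \<Rightarrow> bool" where
  "subalgebra A B \<longleftrightarrow>
     B \<subseteq> carrier A \<and>
     (\<forall>\<alpha>. \<forall>x\<in>B. tensor A \<alpha> x \<in> B) \<and>
     (\<forall>\<alpha>. \<forall>x\<in>B. cotensor A \<alpha> x \<in> B) \<and>
     (\<forall>S. S \<subseteq> B \<longrightarrow> \<Squnion>\<^bsub>underlying A\<^esub> S \<in> B) \<and>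
     (\<forall>S. S \<subseteq> B \<longrightarrow> \<Sqinter>\<^bsub>underlying A\<^esub> S \<in> B)"

definition closure_operator :: "('a, 'q::comm_unital_quantale) ocat \<Rightarrow> ('a \<Rightarrow> 'a) \<Rightarrow> bool" where
  "closure_operator A c \<longleftrightarrow>
     omega_functor A A c \<and>
     (\<forall>x\<in>carrier A. c (c x) = c x) \<and>
     (\<forall>x\<in>carrier A. 1 \<le> ehom A x (c x))"

definition pushforward ::
    "('a, 'q::comm_unital_quantale) ocat \<Rightarrow> ('a \<Rightarrow> 'b) \<Rightarrow> ('a \<Rightarrow> 'q) \<Rightarrow> 'b \<Rightarrow> 'q" where
  "pushforward A f \<mu> b = (SUP x\<in>{x\<in>carrier A. f x = b}. \<mu> x)"

definition cocontinuous ::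
    "('a, 'q::comm_unital_quantale) ocat \<Rightarrow> ('b, 'q) ocat \<Rightarrow> ('a \<Rightarrow> 'b) \<Rightarrow> bool" where
  "cocontinuous A B f \<longleftrightarrow>
     omega_functor A B f \<and>
     (\<forall>\<mu> a. is_osup A \<mu> a \<longrightarrow> is_osup B (pushforward A f \<mu>) (f a))"

definition cocontinuous_closure_operator ::
    "('a, 'q::comm_unital_quantale) ocat \<Rightarrow> ('a \<Rightarrow> 'a) \<Rightarrow> bool" where
  "cocontinuous_closure_operator A c \<longleftrightarrow> closure_operator A c \<and> cocontinuous A A c"

definition subalgebra_closure :: "('a, 'q::comm_unital_quantale) ocat \<Rightarrow> 'a set \<Rightarrow> 'a \<Rightarrow> 'a" where
  "subalgebra_closure A B =
     (\<lambda>x\<in>carrier A. \<Sqinter>\<^bsub>underlying A\<^esub> {y \<in> B. x \<sqsubseteq>\<^bsub>underlying A\<^esub> y})"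

end

theory Submission
  imports Defs
begin

text \<open>
  A subset closed under cotensors and meets is exactly a reflective one: the cotensor
  \<open>A(x,y) \<rightarrowtail> y\<close> of any \<open>y \<in> B\<close> lies in \<open>B\<close> and above \<open>x\<close>, so it lies above \<open>c\<^sub>B(x)\<close>, and
  this says \<open>A(x,y) \<le> A(c\<^sub>B(x),y)\<close> (\<open>closure_hom\<close>). Hence \<open>c\<^sub>B\<close> is an \<open>\<Omega>\<close>-enriched closure
  operator whose fixed points are the elements of \<open>B\<close>, and conversely a closure operator is
  determined by its fixed points, which are closed under cotensors and meets because
  \<open>A(c(x),y) = A(x,y)\<close> for every fixed point \<open>y\<close>.

  It remains to match the other half of the definition of a subalgebra with cocontinuity.
  Every supremum is a join of tensors, \<open>sup \<mu> = \<Squnion> \<mu>(z) \<otimes> z\<close>, so closure of \<open>B\<close> under tensors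
  and joins means closure under all suprema of weights supported on \<open>B\<close>
  (\<open>subalgebra_closed_osup\<close>). The supremum of the weight \<open>\<mu>\<close> pushed forward along \<open>c\<^sub>B\<close> is
  thus an element of \<open>B\<close>; it lies above \<open>sup \<mu>\<close>, hence above \<open>c\<^sub>B(sup \<mu>)\<close>, and the reverse
  inequality holds for every functor (\<open>subalgebra_closure_cocontinuous\<close>). Conversely
  tensors and joins are suprema, so a cocontinuous \<open>c\<close> maps a tensor or join of fixed points
  to itself (\<open>range_subalgebra\<close>).

  A complete \<open>\<Omega>\<close>-lattice has a complete dual, and cotensors and meets are the tensors and
  joins of the dual; their universal properties are obtained by this duality.
\<close>

section \<open>Residuation\<close>

lemma bot_mult_le:
  fixes a c :: "'q::comm_unital_quantale"
  shows "bot * a \<le> c"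
  by (simp add: mult.commute [of bot] residuation)

lemma SUP_mult_le_iff:
  fixes c :: "'q::comm_unital_quantale"
  shows "(SUP i\<in>I. f i) * q \<le> c \<longleftrightarrow> (\<forall>i\<in>I. f i * q \<le> c)"
  by (simp add: mult.commute [of _ q] residuation SUP_le_iff)

section \<open>Suprema, tensors and joins\<close>

lemma eq_iff_lower:
  fixes x y :: "'q::comm_unital_quantale"
  shows "x = y \<longleftrightarrow> (\<forall>q. q \<le> x \<longleftrightarrow> q \<le> y)"
  by (auto intro: order_antisym)

text \<open>
  Testing homs against arbitrary lower bounds \<open>q\<close> replaces infima and residuals by
  quantified inequalities between products; all later computations take place in this form.
\<close>

lemma is_osup_iff:
  "is_osup A \<phi> a \<longleftrightarrow> a \<in> carrier A \<and>
     (\<forall>x\<in>carrier A. \<forall>q. q \<le> ehom A a x \<longleftrightarrow> (\<forall>z\<in>carrier A. \<phi> z * q \<le> ehom A z x))"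
proof -
  have "ehom A a x = (INF z\<in>carrier A. \<phi> z \<leadsto> ehom A z x) \<longleftrightarrow>
      (\<forall>q. q \<le> ehom A a x \<longleftrightarrow> (\<forall>z\<in>carrier A. \<phi> z * q \<le> ehom A z x))" for x
  proof -
    have "q \<le> (INF z\<in>carrier A. \<phi> z \<leadsto> ehom A z x) \<longleftrightarrow>
        (\<forall>z\<in>carrier A. \<phi> z * q \<le> ehom A z x)" for q
      by (simp add: le_INF_iff residuation)
    then show ?thesis
      by (simp add: eq_iff_lower)
  qed
  then show ?thesis
    by (simp add: is_osup_def)
qed

lemma osup_carrier: "is_osup A \<phi> a \<Longrightarrow> a \<in> carrier A"
  by (simp add: is_osup_def)

lemma le_osup_hom_iff:
  assumes "is_osup A \<phi> a" "x \<in> carrier A"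
  shows "q \<le> ehom A a x \<longleftrightarrow> (\<forall>z\<in>carrier A. \<phi> z * q \<le> ehom A z x)"
  using assms by (simp add: is_osup_iff)

lemma hom_comp:
  assumes "omega_category A" "p \<le> ehom A a b" "q \<le> ehom A b c"
    and "a \<in> carrier A" "b \<in> carrier A" "c \<in> carrier A"
  shows "p * q \<le> ehom A a c"
  using assms quantale_mult_mono order_trans unfolding omega_category_def by meson

lemma antisymmetric_iff:
  assumes "omega_category A"
  shows "antisymmetric A \<longleftrightarrow> (\<forall>a\<in>carrier A. \<forall>b\<in>carrier A.
    1 \<le> ehom A a b \<longrightarrow> 1 \<le> ehom A b a \<longrightarrow> a = b)"
proof
  assume "antisymmetric A"
  then interpret partial_order "underlying A"
    by (simp add: antisymmetric_def)
  show "\<forall>a\<in>carrier A. \<forall>b\<in>carrier A. 1 \<le> ehom A a b \<longrightarrow> 1 \<le> ehom A b a \<longrightarrow> a = b"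
    using le_antisym by (simp add: underlying_def)
next
  assume anti: "\<forall>a\<in>carrier A. \<forall>b\<in>carrier A. 1 \<le> ehom A a b \<longrightarrow> 1 \<le> ehom A b a \<longrightarrow> a = b"
  have "1 \<le> ehom A a c" if "1 \<le> ehom A a b" "1 \<le> ehom A b c"
    "a \<in> carrier A" "b \<in> carrier A" "c \<in> carrier A" for a b c
    using hom_comp [OF assms that] by simp
  moreover have "1 \<le> ehom A a a" if "a \<in> carrier A" for a
    using assms that by (simp add: omega_category_def)
  ultimately show "antisymmetric A"
    using anti unfolding antisymmetric_def
    by unfold_locales (auto simp: underlying_def)
qed

context
  fixes A :: "('a, 'q::comm_unital_quantale) ocat"
  assumes complete: "complete_omega_lattice A"
begin

lemma cat: "omega_category A"
  using complete by (simp add: complete_omega_lattice_def)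

lemma hom_refl: "a \<in> carrier A \<Longrightarrow> 1 \<le> ehom A a a"
  using cat by (simp add: omega_category_def)

lemma hom_antisym:
  "\<lbrakk>1 \<le> ehom A a b; 1 \<le> ehom A b a; a \<in> carrier A; b \<in> carrier A\<rbrakk> \<Longrightarrow> a = b"
  using complete antisymmetric_iff [OF cat] unfolding complete_omega_lattice_def by blast

lemma hom_ext:
  assumes "a \<in> carrier A" "b \<in> carrier A"
    and "\<And>x. x \<in> carrier A \<Longrightarrow> ehom A a x = ehom A b x"
  shows "a = b"
proof (rule hom_antisym)
  show "1 \<le> ehom A a b"
    using hom_refl [OF assms(2)] by (simp only: assms(3) [OF assms(2)])
  show "1 \<le> ehom A b a"
    using hom_refl [OF assms(1)] by (simp only: assms(3) [OF assms(1), symmetric])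
qed (fact assms(1,2))+

lemma ex_osup: "\<exists>a. is_osup A \<phi> a"
  using complete by (simp add: complete_omega_lattice_def)

text \<open>
  The tensor is the supremum of the weight concentrated at \<open>x\<close> with value \<open>\<alpha>\<close>.
\<close>

lemma tensor_is_osup:
  assumes "x \<in> carrier A"
  shows "is_osup A (\<lambda>z. if z = x then \<alpha> else bot) (tensor A \<alpha> x)"
proof -
  obtain a where a: "is_osup A (\<lambda>z. if z = x then \<alpha> else bot) a"
    using ex_osup by blast
  have hom: "ehom A a y = \<alpha> \<leadsto> ehom A x y" if "y \<in> carrier A" for y
  proof -
    have "q \<le> ehom A a y \<longleftrightarrow> q \<le> \<alpha> \<leadsto> ehom A x y" for q
      using le_osup_hom_iff [OF a that] assms
      by (auto simp: bot_mult_le residuation [symmetric] split: if_splits)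
    then show ?thesis by (simp add: eq_iff_lower)
  qed
  have "tensor A \<alpha> x = a"
    unfolding tensor_def
    by (rule the_equality) (use hom osup_carrier [OF a] hom_ext in auto)
  with a show ?thesis by simp
qed

lemma tensor_carrier: "x \<in> carrier A \<Longrightarrow> tensor A \<alpha> x \<in> carrier A"
  using tensor_is_osup osup_carrier by metis

lemma le_tensor_hom_iff:
  assumes "x \<in> carrier A" "y \<in> carrier A"
  shows "q \<le> ehom A (tensor A \<alpha> x) y \<longleftrightarrow> \<alpha> * q \<le> ehom A x y"
  using le_osup_hom_iff [OF tensor_is_osup [OF assms(1), of \<alpha>] assms(2)] assms(1)
  by (auto simp: bot_mult_le split: if_splits)

text \<open>
  A join in the underlying order is only required to satisfy a condition at the unit. Since
  the supremum of the indicator weight exists and is such a join, joins are automatically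
  enriched: the hom out of a join is the infimum of the homs.
\<close>

lemma join_is_osup:
  assumes "S \<subseteq> carrier A"
  shows "is_osup A (\<lambda>z. if z \<in> S then 1 else bot) (\<Squnion>\<^bsub>underlying A\<^esub> S)"
proof -
  obtain a where a: "is_osup A (\<lambda>z. if z \<in> S then 1 else bot) a"
    using ex_osup by blast
  have hom: "q \<le> ehom A a y \<longleftrightarrow> (\<forall>w\<in>S. q \<le> ehom A w y)" if "y \<in> carrier A" for y q
    using le_osup_hom_iff [OF a that] assms by (auto simp: bot_mult_le split: if_splits)
  have least: "least (underlying A) a (Upper (underlying A) S)"
    using hom [of _ 1] hom [of a 1] hom_refl osup_carrier [OF a] assms
    by (auto simp: least_def Upper_def underlying_def)
  interpret partial_order "underlying A"
    using complete by (simp add: complete_omega_lattice_def antisymmetric_def)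
  have "\<Squnion>\<^bsub>underlying A\<^esub> S = a"
    unfolding Lattice.sup_def
    by (rule some_equality) (use least least_unique in auto)
  with a show ?thesis by simp
qed

lemma join_carrier: "S \<subseteq> carrier A \<Longrightarrow> \<Squnion>\<^bsub>underlying A\<^esub> S \<in> carrier A"
  using join_is_osup osup_carrier by metis

lemma le_join_hom_iff:
  assumes "S \<subseteq> carrier A" "y \<in> carrier A"
  shows "q \<le> ehom A (\<Squnion>\<^bsub>underlying A\<^esub> S) y \<longleftrightarrow> (\<forall>w\<in>S. q \<le> ehom A w y)"
  using le_osup_hom_iff [OF join_is_osup [OF assms(1)] assms(2)] assms(1)
  by (auto simp: bot_mult_le split: if_splits)

section \<open>The dual of a complete lattice\<close>

text \<open>
  The infimum of a weight \<open>\<psi>\<close> is the supremum of its lower bounds, where \<open>\<mu> z\<close> below is the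
  degree to which \<open>z\<close> is a lower bound of \<open>\<psi>\<close>.
\<close>

lemma complete_op: "complete_omega_lattice (op_cat A)"
proof -
  have cat_op: "omega_category (op_cat A)"
    unfolding omega_category_def op_cat_def
    by (auto simp: hom_refl) (metis cat hom_comp mult.commute order_refl)
  have "antisymmetric (op_cat A)"
    unfolding antisymmetric_iff [OF cat_op] using hom_antisym by (auto simp: op_cat_def)
  moreover have "\<exists>a. is_osup (op_cat A) \<psi> a" for \<psi>
  proof -
    define \<mu> where "\<mu> z = (INF y\<in>carrier A. \<psi> y \<leadsto> ehom A z y)" for z
    have \<mu>: "q \<le> \<mu> z \<longleftrightarrow> (\<forall>y\<in>carrier A. \<psi> y * q \<le> ehom A z y)" for q z
      by (simp add: \<mu>_def le_INF_iff residuation)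
    obtain a where a: "is_osup A \<mu> a"
      using ex_osup by blast
    have aA: "a \<in> carrier A"
      by (rule osup_carrier [OF a])
    have "\<mu> z * \<psi> y \<le> ehom A z y" if "y \<in> carrier A" for y z
      using \<mu> [of "\<mu> z" z] that by (simp add: mult.commute)
    then have lower: "\<psi> y \<le> ehom A a y" if "y \<in> carrier A" for y
      using that by (simp add: le_osup_hom_iff [OF a that])
    have "q \<le> ehom A x a \<longleftrightarrow> q \<le> \<mu> x" if x: "x \<in> carrier A" for x q
    proof
      assume q: "q \<le> ehom A x a"
      show "q \<le> \<mu> x"
        unfolding \<mu> using hom_comp [OF cat q lower] x aA by (simp add: mult.commute)
    next
      assume "q \<le> \<mu> x"
      also have "\<mu> x \<le> ehom A x a"
        using le_osup_hom_iff [OF a aA, of 1] hom_refl [OF aA] x by simp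
      finally show "q \<le> ehom A x a" .
    qed
    then have "is_osup (op_cat A) \<psi> a"
      using aA \<mu> by (simp add: is_osup_iff op_cat_def)
    then show ?thesis ..
  qed
  ultimately show ?thesis
    using cat_op by (simp add: complete_omega_lattice_def)
qed

end

lemma cotensor_eq_tensor_op: "cotensor A = tensor (op_cat A)"
  by (intro ext) (simp add: cotensor_def tensor_def op_cat_def)

lemma meet_eq_join_op: "\<Sqinter>\<^bsub>underlying A\<^esub> S = \<Squnion>\<^bsub>underlying (op_cat A)\<^esub> S"
  by (simp add: Lattice.inf_def Lattice.sup_def greatest_def least_def Lower_def Upper_def
      underlying_def op_cat_def)

context
  fixes A :: "('a, 'q::comm_unital_quantale) ocat"
  assumes complete: "complete_omega_lattice A"
begin

lemmas hom_refl' = hom_refl [OF complete]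
lemmas hom_comp' = hom_comp [OF cat [OF complete]]

lemma cotensor_carrier: "x \<in> carrier A \<Longrightarrow> cotensor A \<alpha> x \<in> carrier A"
  using tensor_carrier [OF complete_op [OF complete]]
  by (simp add: cotensor_eq_tensor_op) (simp add: op_cat_def)

lemma le_hom_cotensor_iff:
  assumes "x \<in> carrier A" "z \<in> carrier A"
  shows "q \<le> ehom A z (cotensor A \<alpha> x) \<longleftrightarrow> \<alpha> * q \<le> ehom A z x"
  using le_tensor_hom_iff [OF complete_op [OF complete], of x z q \<alpha>] assms
  by (simp add: cotensor_eq_tensor_op) (simp add: op_cat_def)

lemma meet_carrier: "S \<subseteq> carrier A \<Longrightarrow> \<Sqinter>\<^bsub>underlying A\<^esub> S \<in> carrier A"
  using join_carrier [OF complete_op [OF complete], of S]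
  by (simp add: meet_eq_join_op) (simp add: op_cat_def)

lemma le_hom_meet_iff:
  assumes "S \<subseteq> carrier A" "z \<in> carrier A"
  shows "q \<le> ehom A z (\<Sqinter>\<^bsub>underlying A\<^esub> S) \<longleftrightarrow> (\<forall>w\<in>S. q \<le> ehom A z w)"
  using le_join_hom_iff [OF complete_op [OF complete], of S z q] assms
  by (simp add: meet_eq_join_op) (simp add: op_cat_def)

section \<open>From subalgebras to closure operators\<close>

text \<open>
  The supremum \<open>s\<close> is the join of the tensors \<open>\<nu>(z) \<otimes> z\<close> with \<open>z \<in> B\<close>.
\<close>

lemma subalgebra_closed_osup:
  assumes "subalgebra A B" and s: "is_osup A \<nu> s" and supp: "\<And>z. z \<notin> B \<Longrightarrow> \<nu> z = bot"
  shows "s \<in> B"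
proof -
  let ?S = "(\<lambda>z. tensor A (\<nu> z) z) ` B"
  let ?t = "\<Squnion>\<^bsub>underlying A\<^esub> ?S"
  have B: "B \<subseteq> carrier A" and SB: "?S \<subseteq> B"
    using assms(1) by (auto simp: subalgebra_def)
  then have t: "?t \<in> B"
    using assms(1) unfolding subalgebra_def by blast
  have S: "?S \<subseteq> carrier A"
    using SB B by blast
  have "q \<le> ehom A s x \<longleftrightarrow> q \<le> ehom A ?t x" if x: "x \<in> carrier A" for x q
  proof -
    have "q \<le> ehom A ?t x \<longleftrightarrow> (\<forall>z\<in>B. \<nu> z * q \<le> ehom A z x)"
      using B x by (simp add: le_join_hom_iff [OF complete S x] le_tensor_hom_iff [OF complete]
          subset_iff cong: ball_cong)
    also have "\<dots> \<longleftrightarrow> (\<forall>z\<in>carrier A. \<nu> z * q \<le> ehom A z x)"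
      using B supp bot_mult_le by (metis subsetD)
    finally show ?thesis
      by (simp add: le_osup_hom_iff [OF s x])
  qed
  then have "s = ?t"
    using B t osup_carrier [OF s] by (intro hom_ext [OF complete]) (auto intro: order_antisym)
  with t show ?thesis by simp
qed

context
  fixes B c
  assumes B: "subalgebra A B"
  defines "c \<equiv> subalgebra_closure A B"
begin

lemma B_carrier: "x \<in> B \<Longrightarrow> x \<in> carrier A"
  using B by (auto simp: subalgebra_def)

lemma closure_eq:
  "x \<in> carrier A \<Longrightarrow> c x = \<Sqinter>\<^bsub>underlying A\<^esub> {y \<in> B. 1 \<le> ehom A x y}"
  by (simp add: c_def subalgebra_closure_def) (simp add: underlying_def)

lemma closure_mem: "x \<in> carrier A \<Longrightarrow> c x \<in> B"
  using B by (auto simp: closure_eq subalgebra_def)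

lemma closure_above: "x \<in> carrier A \<Longrightarrow> 1 \<le> ehom A x (c x)"
  using B_carrier by (subst closure_eq) (auto simp: le_hom_meet_iff subset_iff)

text \<open>
  The closure is the enriched reflection into \<open>B\<close>. The nontrivial inequality comes from the
  cotensor \<open>A(x,y) \<rightarrowtail> y\<close>, one of the elements of which \<open>c\<^sub>B(x)\<close> is the meet.
\<close>

lemma closure_hom:
  assumes x: "x \<in> carrier A" and y: "y \<in> B"
  shows "ehom A (c x) y = ehom A x y"
proof (rule order_antisym)
  have yA: "y \<in> carrier A" and cxA: "c x \<in> carrier A"
    using B_carrier y closure_mem x by auto
  show "ehom A (c x) y \<le> ehom A x y"
    using hom_comp' [OF closure_above [OF x] order_refl x cxA yA] by simp
  let ?w = "cotensor A (ehom A x y) y"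
  have w: "?w \<in> {w \<in> B. 1 \<le> ehom A x w}"
    using B x y yA by (auto simp: le_hom_cotensor_iff subalgebra_def)
  have "1 \<le> ehom A (c x) (c x)"
    by (rule hom_refl' [OF cxA])
  then have "1 \<le> ehom A (c x) ?w"
    using w B_carrier cxA
    by (subst (asm) (2) closure_eq [OF x]) (auto simp: le_hom_meet_iff subset_iff)
  then show "ehom A x y \<le> ehom A (c x) y"
    by (simp add: le_hom_cotensor_iff [OF yA cxA])
qed

lemma closure_fixes: "y \<in> B \<Longrightarrow> c y = y"
  using hom_antisym [OF complete] closure_hom closure_above B_carrier closure_mem hom_refl'
  by metis

lemma subalgebra_closure_functor: "omega_functor A A c"
proof -
  have "c \<in> carrier A \<rightarrow>\<^sub>E carrier A"
    using closure_mem B_carrier by (auto simp: c_def subalgebra_closure_def)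
  moreover have "ehom A a b \<le> ehom A (c a) (c b)" if ab: "a \<in> carrier A" "b \<in> carrier A" for a b
    using hom_comp' [OF order_refl [of "ehom A a b"] closure_above] ab closure_mem B_carrier
    by (simp add: closure_hom)
  ultimately show ?thesis by (simp add: omega_functor_def)
qed

lemma subalgebra_closure_closure_operator: "closure_operator A c"
  using subalgebra_closure_functor closure_above closure_mem closure_fixes
  by (auto simp: closure_operator_def)

lemma subalgebra_closure_range: "c ` carrier A = B"
  using closure_mem closure_fixes B_carrier by (metis image_iff subsetI equalityI image_subsetI)

end

section \<open>Suprema of pushed-forward weights\<close>

lemma le_osup_pushforward_hom_iff:
  assumes "is_osup A (pushforward A f \<mu>) s" "f \<in> carrier A \<rightarrow> carrier A" "x \<in> carrier A"
  shows "q \<le> ehom A s x \<longleftrightarrow> (\<forall>z\<in>carrier A. \<mu> z * q \<le> ehom A (f z) x)"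
  using assms(2) by (auto simp: le_osup_hom_iff [OF assms(1,3)] pushforward_def SUP_mult_le_iff)

lemma pushforward_outside:
  "b \<notin> f ` carrier A \<Longrightarrow> pushforward A f \<mu> b = bot"
  unfolding pushforward_def by (auto intro!: SUP_eq_const simp: bot_unique)

text \<open>
  Let \<open>s\<close> be the supremum of \<open>\<mu>\<close> pushed forward along \<open>c\<^sub>B\<close>. It lies in \<open>B\<close> because this
  weight is supported there, so \<open>A(c\<^sub>B(a),s) = A(a,s)\<close> for the supremum \<open>a\<close> of \<open>\<mu>\<close>, and
  \<open>a \<le> s\<close> since \<open>z \<le> c\<^sub>B(z)\<close>.
\<close>

lemma subalgebra_closure_cocontinuous:
  assumes B: "subalgebra A B"
  shows "cocontinuous A A (subalgebra_closure A B)"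
proof -
  let ?c = "subalgebra_closure A B"
  have ftr: "omega_functor A A ?c"
    by (rule subalgebra_closure_functor [OF B])
  then have c: "?c \<in> carrier A \<rightarrow> carrier A"
    by (auto simp: omega_functor_def)
  have "is_osup A (pushforward A ?c \<mu>) (?c a)" if a: "is_osup A \<mu> a" for \<mu> a
  proof -
    obtain s where s: "is_osup A (pushforward A ?c \<mu>) s"
      using ex_osup [OF complete] by blast
    note aA = osup_carrier [OF a] and sA = osup_carrier [OF s]
    have caA: "?c a \<in> carrier A"
      using c aA by blast
    have sB: "s \<in> B"
      by (rule subalgebra_closed_osup [OF B s])
        (simp add: pushforward_outside subalgebra_closure_range [OF B])
    have "\<mu> z \<le> ehom A z s" if z: "z \<in> carrier A" for z
      using le_osup_pushforward_hom_iff [OF s c sA, of 1] hom_refl' [OF sA] z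
      by (simp add: closure_hom [OF B _ sB])
    then have "1 \<le> ehom A (?c a) s"
      by (simp add: closure_hom [OF B aA sB] le_osup_hom_iff [OF a sA])
    moreover have "\<mu> z \<le> ehom A (?c z) (?c a)" if z: "z \<in> carrier A" for z
    proof -
      have "\<mu> z \<le> ehom A z a"
        using le_osup_hom_iff [OF a aA, of 1] hom_refl' [OF aA] z by simp
      also have "\<dots> \<le> ehom A (?c z) (?c a)"
        using ftr z aA by (simp add: omega_functor_def)
      finally show ?thesis .
    qed
    then have "1 \<le> ehom A s (?c a)"
      by (simp add: le_osup_pushforward_hom_iff [OF s c caA])
    ultimately have "?c a = s"
      using hom_antisym [OF complete] caA sA by blast
    with s show ?thesis by simp
  qed
  with ftr show ?thesis by (simp add: cocontinuous_def)
qed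

section \<open>From closure operators to subalgebras\<close>

context
  fixes c
  assumes c: "closure_operator A c"
begin

lemma operator_carrier: "x \<in> carrier A \<Longrightarrow> c x \<in> carrier A"
  using c by (auto simp: closure_operator_def omega_functor_def)

lemma operator_above: "x \<in> carrier A \<Longrightarrow> 1 \<le> ehom A x (c x)"
  using c by (simp add: closure_operator_def)

lemma mem_range_iff: "x \<in> c ` carrier A \<longleftrightarrow> x \<in> carrier A \<and> c x = x"
  using c operator_carrier by (force simp: closure_operator_def)

lemma mem_range_if_below:
  "\<lbrakk>x \<in> carrier A; 1 \<le> ehom A (c x) x\<rbrakk> \<Longrightarrow> x \<in> c ` carrier A"
  using hom_antisym [OF complete] operator_above operator_carrier mem_range_iff by blast

lemma operator_hom_le:
  assumes "x \<in> carrier A" "y \<in> c ` carrier A"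
  shows "ehom A x y \<le> ehom A (c x) y"
proof -
  have "ehom A x y \<le> ehom A (c x) (c y)"
    using c assms mem_range_iff unfolding closure_operator_def omega_functor_def by blast
  then show ?thesis
    using assms(2) mem_range_iff by simp
qed

lemma closure_of_range: "subalgebra_closure A (c ` carrier A) = c"
proof
  fix x
  show "subalgebra_closure A (c ` carrier A) x = c x"
  proof (cases "x \<in> carrier A")
    case True
    let ?U = "{y \<in> c ` carrier A. 1 \<le> ehom A x y}"
    have U: "?U \<subseteq> carrier A" and cxU: "c x \<in> ?U"
      using operator_carrier operator_above True by auto
    note cxA = operator_carrier [OF True] and mA = meet_carrier [OF U]
    have "1 \<le> ehom A (c x) (\<Sqinter>\<^bsub>underlying A\<^esub> ?U)"
      using operator_hom_le [OF True] by (auto simp: le_hom_meet_iff [OF U cxA] intro: order_trans)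
    moreover have "1 \<le> ehom A (\<Sqinter>\<^bsub>underlying A\<^esub> ?U) (c x)"
      using le_hom_meet_iff [OF U mA, of 1] hom_refl' [OF mA] cxU by blast
    ultimately have "\<Sqinter>\<^bsub>underlying A\<^esub> ?U = c x"
      using hom_antisym [OF complete] cxA mA by blast
    then show ?thesis
      using True by (simp add: subalgebra_closure_def) (simp add: underlying_def)
  next
    case False
    then have "c x = undefined"
      using c by (auto simp: closure_operator_def omega_functor_def)
    with False show ?thesis by (simp add: subalgebra_closure_def)
  qed
qed

text \<open>
  A weight supported on fixed points agrees with its pushforward along \<open>c\<close>, so both have
  the same supremum, and cocontinuity makes it a fixed point.
\<close>

lemma range_closed_osup:
  assumes "cocontinuous A A c" and a: "is_osup A \<mu> a"
    and supp: "\<And>z. z \<notin> c ` carrier A \<Longrightarrow> \<mu> z = bot"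
  shows "a \<in> c ` carrier A"
proof (rule mem_range_if_below)
  show aA: "a \<in> carrier A"
    by (rule osup_carrier [OF a])
  have "is_osup A (pushforward A c \<mu>) (c a)"
    using assms by (simp add: cocontinuous_def)
  moreover have "\<mu> z * 1 \<le> ehom A (c z) a" if "z \<in> carrier A" for z
  proof (cases "z \<in> c ` carrier A")
    case True
    then show ?thesis
      using le_osup_hom_iff [OF a aA, of 1] hom_refl' [OF aA] that mem_range_iff by simp
  next
    case False
    then show ?thesis by (simp only: supp [OF False] bot_mult_le)
  qed
  ultimately show "1 \<le> ehom A (c a) a"
    using aA operator_carrier by (subst le_osup_pushforward_hom_iff) auto
qed

lemma range_subalgebra:
  assumes coc: "cocontinuous A A c"
  shows "subalgebra A (c ` carrier A)"
proof -
  let ?B = "c ` carrier A"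
  have B: "?B \<subseteq> carrier A"
    using operator_carrier by blast
  have "tensor A \<alpha> x \<in> ?B" if "x \<in> ?B" for \<alpha> x
    using that B by (intro range_closed_osup [OF coc tensor_is_osup [OF complete]]) auto
  moreover have "\<Squnion>\<^bsub>underlying A\<^esub> S \<in> ?B" if "S \<subseteq> ?B" for S
    using that B by (intro range_closed_osup [OF coc join_is_osup [OF complete]]) auto
  moreover have "cotensor A \<alpha> x \<in> ?B" if x: "x \<in> ?B" for \<alpha> x
  proof (rule mem_range_if_below)
    have xA: "x \<in> carrier A"
      using x B by blast
    show wA: "cotensor A \<alpha> x \<in> carrier A" (is "?w \<in> _")
      by (rule cotensor_carrier [OF xA])
    have "\<alpha> \<le> ehom A ?w x"
      using hom_refl' [OF wA] by (simp add: le_hom_cotensor_iff [OF xA wA])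
    also have "\<dots> \<le> ehom A (c ?w) x"
      by (rule operator_hom_le [OF wA x])
    finally show "1 \<le> ehom A (c ?w) ?w"
      by (simp add: le_hom_cotensor_iff [OF xA operator_carrier [OF wA]])
  qed
  moreover have "\<Sqinter>\<^bsub>underlying A\<^esub> S \<in> ?B" if S: "S \<subseteq> ?B" for S
  proof (rule mem_range_if_below)
    have SA: "S \<subseteq> carrier A"
      using S B by blast
    show mA: "\<Sqinter>\<^bsub>underlying A\<^esub> S \<in> carrier A" (is "?m \<in> _")
      by (rule meet_carrier [OF SA])
    have "1 \<le> ehom A ?m w" if "w \<in> S" for w
      using le_hom_meet_iff [OF SA mA, of 1] hom_refl' [OF mA] that by blast
    then have "1 \<le> ehom A (c ?m) w" if "w \<in> S" for w
      using order_trans [OF _ operator_hom_le [OF mA]] S that by (simp add: subset_iff)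
    then show "1 \<le> ehom A (c ?m) ?m"
      by (simp add: le_hom_meet_iff [OF SA operator_carrier [OF mA]])
  qed
  ultimately show ?thesis
    using B by (simp add: subalgebra_def)
qed

end

end

section \<open>The correspondence\<close>

theorem proposition5p7:
  fixes A :: "('a, 'q::comm_unital_quantale) ocat"
  assumes "complete_omega_lattice A"
    and "completely_distributive A"
  shows "bij_betw (subalgebra_closure A) {B. subalgebra A B} {c. cocontinuous_closure_operator A c} \<and>
    bij_betw (\<lambda>c. c ` carrier A) {c. cocontinuous_closure_operator A c} {B. subalgebra A B} \<and>
    (\<forall>B. subalgebra A B \<longrightarrow> subalgebra_closure A B ` carrier A = B) \<and>
    (\<forall>c. cocontinuous_closure_operator A c \<longrightarrow> subalgebra_closure A (c ` carrier A) = c)"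
proof -
  let ?Sub = "{B. subalgebra A B}" and ?Cl = "{c. cocontinuous_closure_operator A c}"
  note A = assms(1)
  have range_closure: "\<forall>B\<in>?Sub. subalgebra_closure A B ` carrier A = B"
    using subalgebra_closure_range [OF A] by blast
  have closure_range: "\<forall>c\<in>?Cl. subalgebra_closure A (c ` carrier A) = c"
    using closure_of_range [OF A] by (simp add: cocontinuous_closure_operator_def)
  have closure_Cl: "subalgebra_closure A ` ?Sub \<subseteq> ?Cl"
    using subalgebra_closure_closure_operator [OF A] subalgebra_closure_cocontinuous [OF A]
    by (auto simp: cocontinuous_closure_operator_def)
  have range_Sub: "(\<lambda>c. c ` carrier A) ` ?Cl \<subseteq> ?Sub"
    using range_subalgebra [OF A] by (auto simp: cocontinuous_closure_operator_def)
  show ?thesis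
    using bij_betw_byWitness [OF range_closure closure_range closure_Cl range_Sub]
      bij_betw_byWitness [OF closure_range range_closure range_Sub closure_Cl]
      range_closure closure_range
    by simp
qed

end
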